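(* Let $\kappa$ be a regular infinite cardinal and $\mu$ a singular cardinal with $\mathrm{cf}(\mu)=\kappa$. Then $\mu^{<\mu}\le\mathrm{non}(\mathcal M_\kappa({}^{\mu}2,\mu))=\mathrm{non}(\mathcal M_\kappa({}^{\mu}\mu,\mu))$.
   Context: For ordinals $\delta,\rho$, ${}^{\delta}\rho$ is the set of functions $\delta\to\rho$; for a partial function $s\colon\delta\rightharpoonup\rho$, $[s]=\{f\in{}^{\delta}\rho: s\subseteq f\}$. The ${<}\mu$-box topology on ${}^{\delta}\rho$ has base $\{[s]: |\mathrm{dom}(s)|<\mu\}$; $(X,\mu)$ denotes $X$ with it. A set is $\kappa$-meagre if it is a union of at most $\kappa$ nowhere dense sets; $\mathcal M_\kappa(X,\tau)$ is the ideal of $\kappa$-meagre subsets; $\mathrm{non}(\mathcal I)$ is the least size of a subset of the space not in $\mathcal I$. *)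

theory Defs
  imports "HOL-Analysis.Analysis"
begin

unbundle cardinal_syntax

definition cyl :: "('a \<rightharpoonup> 'b) \<Rightarrow> ('a \<Rightarrow> 'b) set" where
  "cyl s = {f. s \<subseteq>\<^sub>m (Some \<circ> f)}"

definition box_topology :: "'c rel \<Rightarrow> ('a \<Rightarrow> 'b) topology" where
  "box_topology m = topology_generated_by {cyl s | s. (card_of (dom s), m) \<in> ordLess}"

definition nowhere_dense_in :: "'a topology \<Rightarrow> 'a set \<Rightarrow> bool" where
  "nowhere_dense_in X A \<longleftrightarrow> A \<subseteq> topspace X \<and> X interior_of (X closure_of A) = {}"

definition meagre_k :: "'k rel \<Rightarrow> 'a topology \<Rightarrow> 'a set \<Rightarrow> bool" where
  "meagre_k k X A \<longleftrightarrow> (\<exists>F. (\<forall>N\<in>F. nowhere_dense_in X N) \<and> (card_of F, k) \<in> ordLeq \<and> A = \<Union>F)"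

definition cofinality_is :: "'a rel \<Rightarrow> 'k rel \<Rightarrow> bool" where
  "cofinality_is r k \<longleftrightarrow>
     (\<exists>K. K \<subseteq> Field r \<and> cofinal K r \<and> (card_of K, k) \<in> ordIso) \<and>
     (\<forall>K. K \<subseteq> Field r \<and> cofinal K r \<longrightarrow> (k, card_of K) \<in> ordLeq)"

end

theory Submission
  imports Defs
begin

text \<open>
  Every non-\<open>\<kappa>\<close>-meagre \<open>Y \<subseteq> \<^sup>\<mu>2\<close> has size at least \<open>2\<^sup>\<mu> = \<mu>\<^sup>\<mu>\<close>. Let \<open>K\<close> be cofinal in \<open>\<mu>\<close> with \<open>|K| = \<kappa>\<close>.
  For \<open>j, p \<in> K\<close> reserve a family of disjoint copies, indexed by \<open>a < p\<close>, of the initial segment \<open>j\<close>, and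
  say that \<open>f\<close> decodes \<open>h\<close> on \<open>j\<close> via \<open>p\<close> if \<open>f\<close> agrees with \<open>h\<close> on all but fewer than \<open>|p|\<close> of these
  copies; this determines \<open>h\<close> on \<open>j\<close>. A condition \<open>s\<close> of size \<open>< \<mu>\<close> touches fewer than \<open>|p|\<close> copies
  once \<open>p\<close> is large, and filling all the remaining ones costs \<open>|p| \<cdot> |j| < \<mu>\<close> bits, so the \<open>f\<close> that
  decode \<open>h\<close> on \<open>j\<close> via some \<open>p\<close> contain a dense open set. Hence some \<open>f \<in> Y\<close> decodes \<open>h\<close> on every
  \<open>j \<in> K\<close>, and \<open>h\<close> is recovered from \<open>f\<close> and a subset of \<open>K \<times> K\<close>. Therefore \<open>2\<^sup>\<mu> \<le> |Y| \<cdot> 2\<^sup>\<kappa>\<close>, while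
  \<open>2\<^sup>\<kappa> \<le> |Y|\<close> by diagonalising on \<open>\<mu>\<close> disjoint blocks of size \<open>\<kappa>\<close>. By Baire category \<open>\<^sup>\<mu>\<mu>\<close> itself is
  then a non-meagre set of size \<open>\<le> |Y|\<close>; in the other direction, compose with a surjection \<open>\<mu> \<rightarrow> 2\<close>.
\<close>

section \<open>Cardinal arithmetic below an infinite cardinal and its cofinality\<close>

lemma finite_ordLess_Card_order:
  assumes "\<not> finite (Field r)" "Card_order r" "finite A"
  shows "|A| <o r"
  using assms card_of_Well_order card_order_on_well_order_on
  by (intro finite_ordLess_infinite) (auto simp: Field_card_of)

lemma Times_ordLess_infinite_Field:
  assumes "\<not> finite (Field r)" "Card_order r" "|A| <o r" "|B| <o r"
  shows "|A \<times> B| <o r"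
proof (cases "finite (A <+> B)")
  case True
  then have "finite (A \<times> B)" by (simp add: finite_Plus_iff)
  then show ?thesis by (rule finite_ordLess_Card_order[OF assms(1,2)])
next
  case False
  have "|A \<times> B| \<le>o |A <+> B|"
    using card_of_Sigma_ordLeq_infinite[OF False, of A "\<lambda>_. B"] card_of_Plus1 card_of_Plus2 by blast
  then show ?thesis
    using card_of_Plus_ordLess_infinite_Field[OF assms] ordLeq_ordLess_trans by blast
qed

lemma ordLess_imp_ordLeq_underS:
  assumes "Card_order r" "|A| <o r"
  shows "\<exists>a\<in>Field r. |A| \<le>o |underS r a|"
proof -
  have "Well_order r" using assms(1) card_order_on_well_order_on by blast
  then obtain a where a: "a \<in> Field r" "|A| =o Restr r (underS r a)"
    using assms(2) ordLess_iff_ordIso_Restr[of r "|A|"] card_of_Well_order by blast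
  have "|A| =o |Field (Restr r (underS r a))|"
    using card_of_cong[OF a(2)] by (simp add: Field_card_of)
  moreover have "|Field (Restr r (underS r a))| \<le>o |underS r a|"
    by (rule card_of_mono1) (auto simp: Field_def)
  ultimately show ?thesis using a(1) ordIso_ordLeq_trans by blast
qed

lemma cofinality_is_ordLeq:
  assumes "cofinality_is r k" "Card_order r"
  shows "k \<le>o r"
proof -
  obtain K where "K \<subseteq> Field r" "|K| =o k" using assms(1) by (auto simp: cofinality_is_def)
  then show ?thesis
    using card_of_mono1 card_of_Field_ordIso[OF assms(2)]
    by (meson ordIso_ordLeq_trans ordIso_symmetric ordLeq_ordIso_trans)
qed

text \<open>Each \<open>A i\<close> fits into an initial segment. Fewer than \<open>k\<close>
  endpoints are not cofinal, so one segment \<open>underS r a\<close> serves for all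
  \<open>i\<close>, and the union has size at most \<open>|I \<times> underS r a|\<close>. This
  keeps unions of conditions small in the Baire argument.\<close>

lemma UNION_ordLess_cofinality:
  assumes r: "Card_order r" "\<not> finite (Field r)" and k: "cofinality_is r k"
    and I: "|I| <o k" and A: "\<And>i. i \<in> I \<Longrightarrow> |A i| <o r"
  shows "|\<Union>i\<in>I. A i| <o r"
proof -
  obtain x where x: "\<And>i. i \<in> I \<Longrightarrow> x i \<in> Field r \<and> |A i| \<le>o |underS r (x i)|"
    using ordLess_imp_ordLeq_underS[OF r(1) A] by metis
  have "\<not> k \<le>o |x ` I|"
    using I card_of_image not_ordLess_ordLeq ordLeq_ordLess_trans by metis
  then have "\<not> cofinal (x ` I) r"
    using k x unfolding cofinality_is_def by blast
  then obtain a where a: "a \<in> Field r" "\<And>i. i \<in> I \<Longrightarrow> a \<noteq> x i \<Longrightarrow> (a, x i) \<notin> r"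
    unfolding cofinal_def by blast
  have lin: "trans r" "antisym r" "total_on (Field r) r"
    using r(1) by (auto simp: card_order_on_def order_on_defs)
  have "underS r (x i) \<subseteq> underS r a" if "i \<in> I" for i
  proof (cases "a = x i")
    case False
    then have "(x i, a) \<in> r" using a that x lin(3) unfolding total_on_def by blast
    then show ?thesis
      using underS_incr[OF lin(1,2)] by blast
  qed simp
  then have "\<forall>i\<in>I. |A i| \<le>o |underS r a|"
    using x card_of_mono1 ordLeq_transitive by metis
  then have "|SIGMA i : I. A i| \<le>o |I \<times> underS r a|"
    by (rule card_of_Sigma_mono1)
  moreover have "|I \<times> underS r a| <o r"
    using Times_ordLess_infinite_Field[OF r(2,1)
        ordLess_ordLeq_trans[OF I cofinality_is_ordLeq[OF k r(1)]] card_of_underS[OF r(1) a(1)]] .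
  ultimately show ?thesis
    by (rule ordLeq_ordLess_trans[OF card_of_UNION_Sigma ordLeq_ordLess_trans])
qed

section \<open>Cylinders and the combinatorial form of nowhere density\<close>

lemma mem_cyl_iff: "f \<in> cyl s \<longleftrightarrow> (\<forall>x y. s x = Some y \<longrightarrow> f x = y)"
  unfolding cyl_def map_le_def dom_def by auto

text \<open>The common point \<open>f\<close> forces \<open>s\<close> and \<open>t\<close> to agree
  where both are defined, so the override \<open>++\<close> is a true union. Hence the generating
  cylinders form a base.\<close>

lemma cyl_union:
  assumes "f \<in> cyl s" "f \<in> cyl t"
  shows "f \<in> cyl (s ++ t)" "cyl (s ++ t) \<subseteq> cyl s \<inter> cyl t"
proof -
  show "f \<in> cyl (s ++ t)" using assms by (auto simp: mem_cyl_iff map_add_Some_iff)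
  have "g \<in> cyl s \<and> g \<in> cyl t" if g: "g \<in> cyl (s ++ t)" for g
  proof -
    have "g x = y" if "s x = Some y" for x y
    proof (cases "t x")
      case None
      then show ?thesis using g that by (auto simp: mem_cyl_iff map_add_Some_iff)
    next
      case (Some z)
      then have "g x = z" using g by (auto simp: mem_cyl_iff map_add_Some_iff)
      moreover have "z = y" using assms that Some by (auto simp: mem_cyl_iff)
      ultimately show ?thesis by simp
    qed
    then show ?thesis using g by (auto simp: mem_cyl_iff map_add_Some_iff)
  qed
  then show "cyl (s ++ t) \<subseteq> cyl s \<inter> cyl t" by blast
qed

locale infinite_card_order =
  fixes r :: "'c rel"
  assumes Card: "Card_order r" and inf: "\<not> finite (Field r)"
begin

lemma finite_ordLess: "finite A \<Longrightarrow> |A| <o r"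
  using finite_ordLess_Card_order[OF inf Card] .

lemma subset_ordLess: "B \<subseteq> A \<Longrightarrow> |A| <o r \<Longrightarrow> |B| <o r"
  using card_of_mono1 ordLeq_ordLess_trans by blast

lemma Un_ordLess: "|A| <o r \<Longrightarrow> |B| <o r \<Longrightarrow> |A \<union> B| <o r"
  using card_of_Un_ordLess_infinite_Field[OF inf Card] .

lemma topspace_box_topology [simp]:
  "topspace (box_topology r :: ('a \<Rightarrow> 'b) topology) = UNIV"
proof -
  have "cyl (Map.empty :: 'a \<rightharpoonup> 'b) = UNIV" by (auto simp: cyl_def)
  moreover have "|dom (Map.empty :: 'a \<rightharpoonup> 'b)| <o r" by (intro finite_ordLess) simp
  ultimately show ?thesis unfolding box_topology_def topology_generated_by_topspace by blast
qed

lemma openin_cyl: "|dom s| <o r \<Longrightarrow> openin (box_topology r) (cyl s)"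
  unfolding box_topology_def by (rule topology_generated_by_Basis) blast

lemma openin_box_topology_imp:
  assumes "openin (box_topology r) U" "f \<in> U"
  shows "\<exists>s. |dom s| <o r \<and> f \<in> cyl s \<and> cyl s \<subseteq> U"
  using assms unfolding box_topology_def openin_topology_generated_by_iff
proof (induction arbitrary: f)
  case (Int a b)
  then obtain s t where "|dom s| <o r" "f \<in> cyl s" "cyl s \<subseteq> a" "|dom t| <o r" "f \<in> cyl t" "cyl t \<subseteq> b"
    by (meson IntD1 IntD2)
  then show ?case
    using cyl_union[of f s t] Un_ordLess[of "dom t" "dom s"]
    by (intro exI[of _ "s ++ t"]) auto
next
  case (UN K)
  then show ?case by (meson Sup_upper UnionE subset_trans)
next
  case (Basis S)
  then show ?case by blast
qed simp

lemma cyl_nonempty: "cyl s \<noteq> {}"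
proof -
  \<comment> \<open>Off \<open>dom s\<close> the value \<open>the None\<close> is arbitrary but
    harmless.\<close>
  have "(\<lambda>x. the (s x)) \<in> cyl s" unfolding cyl_def map_le_def by auto
  then show ?thesis by blast
qed

lemma cyl_antimono: "s \<subseteq>\<^sub>m t \<Longrightarrow> cyl t \<subseteq> cyl s"
  unfolding cyl_def using map_le_trans by blast

text \<open>Reduces all later category arguments to extending conditions. A cylinder not inside the
  closure has a point with a basic neighbourhood missing \<open>N\<close>; the union of the two
  conditions is the extension. Conversely, an extension whose cylinder misses \<open>N\<close> keeps
  the given cylinder out of the closure.\<close>

lemma nowhere_dense_box_iff:
  fixes N :: "('a \<Rightarrow> 'b) set"
  shows "nowhere_dense_in (box_topology r) N \<longleftrightarrow>
    (\<forall>s. |dom s| <o r \<longrightarrow> (\<exists>t. s \<subseteq>\<^sub>m t \<and> |dom t| <o r \<and> cyl t \<inter> N = {}))"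
    (is "_ \<longleftrightarrow> ?R")
proof
  assume N: "nowhere_dense_in (box_topology r) N"
  show ?R
  proof (intro allI impI)
    fix s :: "'a \<rightharpoonup> 'b" assume s: "|dom s| <o r"
    have "\<not> cyl s \<subseteq> box_topology r closure_of N"
      using N openin_cyl[OF s] cyl_nonempty[of s] interior_of_maximal
      unfolding nowhere_dense_in_def by (metis subset_empty)
    then obtain f T where f: "f \<in> cyl s" and T: "f \<in> T" "openin (box_topology r) T" "T \<inter> N = {}"
      unfolding closure_of_def by auto
    obtain u where u: "|dom u| <o r" "f \<in> cyl u" "cyl u \<subseteq> T"
      using openin_box_topology_imp[OF T(2,1)] by blast
    have "s \<subseteq>\<^sub>m u ++ s" by simp
    then show "\<exists>t. s \<subseteq>\<^sub>m t \<and> |dom t| <o r \<and> cyl t \<inter> N = {}"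
      using cyl_union[OF u(2) f] u T(3) Un_ordLess[OF s u(1)]
      by (intro exI[of _ "u ++ s"]) auto
  qed
next
  assume R: ?R
  have "box_topology r interior_of (box_topology r closure_of N) = {}"
  proof (rule ccontr)
    assume "box_topology r interior_of (box_topology r closure_of N) \<noteq> {}"
    then obtain f where "f \<in> box_topology r interior_of (box_topology r closure_of N)" by blast
    then obtain s where s: "|dom s| <o r" "cyl s \<subseteq> box_topology r closure_of N"
      using openin_box_topology_imp[OF openin_interior_of] interior_of_subset by (metis subset_trans)
    then obtain t where t: "s \<subseteq>\<^sub>m t" "|dom t| <o r" "cyl t \<inter> N = {}" using R by blast
    obtain g where g: "g \<in> cyl t" using cyl_nonempty by blast
    then have "g \<in> box_topology r closure_of N" using s(2) cyl_antimono[OF t(1)] by blast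
    then show False using openin_cyl[OF t(2)] g t(3) unfolding in_closure_of by blast
  qed
  then show "nowhere_dense_in (box_topology r) N" unfolding nowhere_dense_in_def by simp
qed

lemma nowhere_dense_box_subset:
  fixes N :: "('a \<Rightarrow> 'b) set"
  assumes "nowhere_dense_in (box_topology r) N" "M \<subseteq> N"
  shows "nowhere_dense_in (box_topology r) M"
  using assms unfolding nowhere_dense_box_iff by (meson disjoint_iff subsetD)

end

section \<open>Baire category, and meagreness under composition with a surjection\<close>

lemma map_le_chain_union:
  assumes "\<And>i j. i \<in> I \<Longrightarrow> j \<in> I \<Longrightarrow> f i \<subseteq>\<^sub>m f j \<or> f j \<subseteq>\<^sub>m f i"
  shows "\<exists>u. dom u = (\<Union>i\<in>I. dom (f i)) \<and> (\<forall>i\<in>I. f i \<subseteq>\<^sub>m u)"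
proof -
  \<comment> \<open>\<open>J x\<close> picks an index whose function is defined at \<open>x\<close>;
    comparability makes the value independent of the choice.\<close>
  define J where "J x = (SOME i. i \<in> I \<and> x \<in> dom (f i))" for x
  define u where "u x = (if \<exists>i\<in>I. x \<in> dom (f i) then f (J x) x else None)" for x
  have J: "J x \<in> I \<and> x \<in> dom (f (J x))" if "i \<in> I" "x \<in> dom (f i)" for i x
    unfolding J_def by (rule someI[of _ i]) (use that in blast)
  have "f i x = u x" if "i \<in> I" "x \<in> dom (f i)" for i x
  proof -
    have "f i x = f (J x) x"
      using assms[OF that(1), of "J x"] J[OF that] that(2) unfolding map_le_def by metis
    then show ?thesis using that unfolding u_def by auto
  qed
  moreover have "dom u \<subseteq> (\<Union>i\<in>I. dom (f i))" unfolding u_def by (auto split: if_splits)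
  ultimately show ?thesis
    by (intro exI[of _ u]) (fastforce simp: map_le_def dom_def)
qed

text \<open>\<open>meagre_k\<close> demands equality with the union, so a mere cover is cut down by
  intersecting each member with \<open>A\<close>.\<close>

lemma meagre_k_subset:
  assumes "\<And>N. N \<in> F \<Longrightarrow> nowhere_dense_in X N" "|F| \<le>o k" "A \<subseteq> \<Union>F"
    and sub: "\<And>N M. nowhere_dense_in X N \<Longrightarrow> M \<subseteq> N \<Longrightarrow> nowhere_dense_in X M"
  shows "meagre_k k X A"
  unfolding meagre_k_def
proof (intro exI conjI ballI)
  show "|(\<inter>) A ` F| \<le>o k" using card_of_image assms(2) ordLeq_transitive by blast
  show "A = \<Union> ((\<inter>) A ` F)" using assms(3) by auto
  show "nowhere_dense_in X N" if "N \<in> (\<inter>) A ` F" for N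
    using that assms(1) sub[OF _ Int_lower2] by auto
qed

locale box_cofinality = infinite_card_order r for r :: "'c rel" +
  fixes k :: "'k rel"
  assumes Card_k: "Card_order k" and inf_k: "\<not> finite (Field k)" and cof: "cofinality_is r k"
begin

text \<open>Recursion along \<open>k\<close> builds increasing conditions, the \<open>i\<close>-th
  one avoiding \<open>N i\<close>. Before stage \<open>i\<close> there are fewer than
  \<open>k\<close> of them, so by cofinality their union is still a condition.\<close>

theorem box_topology_Baire: "\<not> meagre_k k (box_topology r) (UNIV :: ('a \<Rightarrow> 'b) set)"
proof
  assume "meagre_k k (box_topology r) (UNIV :: ('a \<Rightarrow> 'b) set)"
  then obtain F :: "('a \<Rightarrow> 'b) set set" where F: "\<forall>N\<in>F. nowhere_dense_in (box_topology r) N"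
    "|F| \<le>o k" "UNIV = \<Union>F" unfolding meagre_k_def by blast
  have "F \<noteq> {}" using F(3) by auto
  moreover have "|F| \<le>o |Field k|"
    using F(2) card_of_Field_ordIso[OF Card_k] ordIso_symmetric ordLeq_ordIso_trans by blast
  ultimately obtain N where N: "N ` Field k = F" by (metis card_of_ordLeq2)
  \<comment> \<open>\<open>P f i t\<close>: \<open>t\<close> is admissible at stage \<open>i\<close>
    after the earlier choices \<open>f\<close>. The recursion runs over the whole type, while
    \<open>N i\<close> is known to be nowhere dense only for \<open>i \<in> Field k\<close>, hence
    the guard.\<close>
  define P where "P f i t \<longleftrightarrow> |dom t| <o r \<and> (\<forall>j\<in>underS k i. f j \<subseteq>\<^sub>m t) \<and> (i \<in> Field k \<longrightarrow> cyl t \<inter> N i = {})"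
    for f :: "'k \<Rightarrow> ('a \<rightharpoonup> 'b)" and i t
  have wo: "wf (k - Id)" "total_on (Field k) k"
    using Card_k by (auto simp: card_order_on_def order_on_defs)
  have underS_iff: "j \<in> underS k i \<longleftrightarrow> (j, i) \<in> k - Id" for i j
    unfolding underS_def by auto
  have chain: "f i \<subseteq>\<^sub>m f j \<or> f j \<subseteq>\<^sub>m f i"
    if "i \<in> Field k" "j \<in> Field k" "P f i (f i)" "P f j (f j)" for f i j
  proof (cases "i = j")
    case False
    then have "j \<in> underS k i \<or> i \<in> underS k j"
      using that(1,2) wo(2) unfolding total_on_def underS_iff by blast
    then show ?thesis using that(3,4) unfolding P_def by blast
  qed simp
  have "\<exists>f. \<forall>i. P f i (f i)"
  proof (rule dependent_wf_choice[OF wo(1)])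
    show "P f x t = P g x t" if "\<And>z. (z, x) \<in> k - Id \<Longrightarrow> f z = g z" for f g x t
      using that unfolding P_def by (simp add: underS_iff)
  next
    fix i f assume IH: "\<And>j. (j, i) \<in> k - Id \<Longrightarrow> P f j (f j)"
    have sub: "underS k i \<subseteq> Field k" unfolding underS_def Field_def by auto
    obtain u where u: "dom u = (\<Union>j\<in>underS k i. dom (f j))" "\<forall>j\<in>underS k i. f j \<subseteq>\<^sub>m u"
    proof -
      have "f j \<subseteq>\<^sub>m f j' \<or> f j' \<subseteq>\<^sub>m f j" if "j \<in> underS k i" "j' \<in> underS k i" for j j'
        using that sub IH by (intro chain) (auto simp: underS_iff)
      then show thesis using map_le_chain_union[of "underS k i" f] that by blast
    qed
    have "|underS k i| <o k"
    proof (cases "i \<in> Field k")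
      case False
      then have "underS k i = {}" unfolding underS_def Field_def by auto
      then show ?thesis
        using finite_ordLess_Card_order[OF inf_k Card_k, of "underS k i"] by simp
    qed (rule card_of_underS[OF Card_k])
    then have u_small: "|dom u| <o r"
      unfolding u(1)
    proof (rule UNION_ordLess_cofinality[OF Card inf cof])
      show "|dom (f j)| <o r" if "j \<in> underS k i" for j
        using IH[of j] that unfolding P_def underS_iff by blast
    qed
    show "\<exists>t. P f i t"
    proof (cases "i \<in> Field k")
      case True
      then have "nowhere_dense_in (box_topology r) (N i)" using F(1) N by blast
      then obtain t where "u \<subseteq>\<^sub>m t" "|dom t| <o r" "cyl t \<inter> N i = {}"
        using u_small unfolding nowhere_dense_box_iff by blast
      then show ?thesis using u(2) map_le_trans unfolding P_def by blast
    next
      case False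
      then show ?thesis using u_small u(2) unfolding P_def by blast
    qed
  qed
  then obtain f where f: "\<And>i. P f i (f i)" by blast
  \<comment> \<open>The final union may be too large to be a condition; only a point extending it is
    needed.\<close>
  obtain u where u: "\<forall>i\<in>Field k. f i \<subseteq>\<^sub>m u" using map_le_chain_union[of "Field k" f] chain f by blast
  obtain g where g: "g \<in> cyl u" using cyl_nonempty by blast
  then have "g \<notin> N i" if "i \<in> Field k" for i
    using cyl_antimono u that f[of i] unfolding P_def by blast
  then show False using F(3) N by blast
qed

end


text \<open>Preimages of nowhere dense sets under \<open>f \<mapsto> P \<circ> f\<close> are nowhere
  dense: project a condition by \<open>P\<close>, extend it to avoid \<open>N\<close>, and lift the
  extension back.\<close>

lemma (in infinite_card_order) meagre_k_comp_image:
  fixes Z :: "('a \<Rightarrow> 'b) set" and P :: "'b \<Rightarrow> 'd"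
  assumes P: "surj P" and m: "meagre_k k (box_topology r) ((\<lambda>f. P \<circ> f) ` Z)"
  shows "meagre_k k (box_topology r) Z"
proof -
  obtain F where F: "\<forall>N\<in>F. nowhere_dense_in (box_topology r) N" "|F| \<le>o k"
    "(\<lambda>f. P \<circ> f) ` Z = \<Union>F" using m unfolding meagre_k_def by blast
  show ?thesis
  proof (rule meagre_k_subset[OF _ _ _ nowhere_dense_box_subset])
    show "|vimage (\<lambda>f. P \<circ> f) ` F| \<le>o k"
      using card_of_image F(2) ordLeq_transitive by blast
    show "Z \<subseteq> \<Union> (vimage (\<lambda>f. P \<circ> f) ` F)" using F(3) by auto
  next
    fix M assume "M \<in> vimage (\<lambda>f. P \<circ> f) ` F"
    then obtain N where N: "N \<in> F" "M = (\<lambda>f. P \<circ> f) -` N" by blast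
    show "nowhere_dense_in (box_topology r) M"
      unfolding nowhere_dense_box_iff
    proof (intro allI impI)
      fix s :: "'a \<rightharpoonup> 'b" assume s: "|dom s| <o r"
      have "dom (map_option P \<circ> s) = dom s" by auto
      then obtain t where t: "map_option P \<circ> s \<subseteq>\<^sub>m t" "|dom t| <o r" "cyl t \<inter> N = {}"
        using F(1) N(1) s unfolding nowhere_dense_box_iff by metis
      \<comment> \<open>\<open>s\<close> takes priority, so \<open>u\<close> extends it;
        \<open>inv P\<close> chooses values only at the new coordinates.\<close>
      define u where "u = (map_option (inv P) \<circ> t) ++ s"
      have "dom u = dom t \<union> dom s" unfolding u_def by (auto simp: dom_map_option_comp)
      then have "|dom u| <o r" using Un_ordLess[OF t(2) s] by simp
      moreover have "P \<circ> f \<in> cyl t" if f: "f \<in> cyl u" for f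
        unfolding mem_cyl_iff
      proof (intro allI impI)
        fix x y assume y: "t x = Some y"
        show "(P \<circ> f) x = y"
        proof (cases "s x")
          case None
          then have "f x = inv P y" using f y unfolding u_def mem_cyl_iff by (auto simp: map_add_Some_iff)
          then show ?thesis using surj_f_inv_f[OF P] by simp
        next
          case (Some z)
          then have "f x = z" using f unfolding u_def mem_cyl_iff by (auto simp: map_add_Some_iff)
          moreover have "x \<in> dom (map_option P \<circ> s)" using Some by auto
          then have "t x = Some (P z)" using t(1) Some unfolding map_le_def by force
          ultimately show ?thesis using y by simp
        qed
      qed
      then have "cyl u \<inter> M = {}" using t(3) N(2) by blast
      ultimately show "\<exists>t. s \<subseteq>\<^sub>m t \<and> |dom t| <o r \<and> cyl t \<inter> M = {}"
        unfolding u_def by (intro exI[of _ u]) (auto simp: u_def)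
    qed
  qed
qed

section \<open>Singular cardinals: coding functions by redundant copies\<close>

locale singular_box = box_cofinality r k for r :: "'m rel" and k :: "'k rel" +
  fixes K :: "'m set" and e :: "'m \<times> 'm \<Rightarrow> 'm"
  assumes Field_r: "Field r = UNIV" and singular: "\<not> regularCard r"
    and K: "cofinal K r" "|K| =o k" and inj_e: "inj e"
begin

lemma inv_e [simp]: "inv e (e x) = x"
  using inj_e by simp

text \<open>Singularity enters here: it yields a cofinal set smaller than \<open>r\<close>, and
  \<open>k\<close> is the least size of a cofinal set.\<close>

lemma K_ordLess: "|K| <o r"
proof -
  obtain K' where K': "cofinal K' r" "\<not> |K'| =o r" using singular unfolding regularCard_def by blast
  have "|K'| \<le>o r"
    using card_of_mono1[of K' "Field r"] card_of_Field_ordIso[OF Card] Field_r ordLeq_ordIso_trans by blast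
  then have "|K'| <o r" using K'(2) ordLeq_iff_ordLess_or_ordIso by blast
  moreover have "k \<le>o |K'|" using cof K'(1) Field_r unfolding cofinality_is_def by blast
  ultimately show ?thesis using K(2) ordIso_ordLeq_trans ordLeq_ordLess_trans by blast
qed

lemma K_infinite: "\<not> finite K"
proof -
  have "|K| =o |Field k|" using K(2) card_of_Field_ordIso[OF Card_k] ordIso_symmetric ordIso_transitive by blast
  then show ?thesis using inf_k card_of_ordIso_finite by blast
qed

lemma Times_ordLess: "|A| <o r \<Longrightarrow> |B| <o r \<Longrightarrow> |A \<times> B| <o r"
  using Times_ordLess_infinite_Field[OF inf Card] .

lemma underS_ordLess: "|underS r a| <o r"
  using card_of_underS[OF Card] Field_r by blast

lemma ex_underS_K: "\<exists>j\<in>K. x \<in> underS r j"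
  using K(1) Field_r unfolding cofinal_def underS_def by auto

lemma ordLess_imp_neq_UNIV: "|A :: 'm set| <o r \<Longrightarrow> A \<noteq> UNIV"
  using card_of_Field_ordIso[OF Card] Field_r not_ordLess_ordIso by metis

text \<open>Otherwise all segments below points of \<open>K\<close> have size at most
  \<open>|A \<union> K|\<close>, and so has their union, which is everything. Adjoining
  \<open>K\<close> makes this bound infinite and at least the number of segments.\<close>

lemma ex_K_underS_large:
  fixes A :: "'m set"
  assumes "|A| <o r"
  shows "\<exists>p\<in>K. |A| <o |underS r p| \<and> \<not> finite (underS r p)"
proof -
  let ?B = "A \<union> K"
  have B: "|?B| <o r" "\<not> finite ?B" using Un_ordLess[OF assms K_ordLess] K_infinite by auto
  have "\<exists>p\<in>K. |?B| <o |underS r p|"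
  proof (rule ccontr)
    assume "\<not> ?thesis"
    then have "\<forall>p\<in>K. |underS r p| \<le>o |?B|"
      using not_ordLess_iff_ordLeq card_of_Well_order by metis
    moreover have "|K| \<le>o |?B|" by (rule card_of_mono1) simp
    ultimately have "|\<Union>p\<in>K. underS r p| \<le>o |?B|"
      using card_of_UNION_ordLeq_infinite[OF B(2)] by blast
    moreover have "(\<Union>p\<in>K. underS r p) = UNIV" using ex_underS_K by blast
    ultimately show False using ordLess_imp_neq_UNIV B(1) ordLeq_ordLess_trans by metis
  qed
  then obtain p where p: "p \<in> K" "|?B| <o |underS r p|" by blast
  moreover have "\<not> finite (underS r p)"
    using card_of_ordLeq_infinite[OF ordLess_imp_ordLeq[OF p(2)] B(2)] .
  moreover have "|A| \<le>o |?B|" by (rule card_of_mono1) simp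
  ultimately show ?thesis using ordLeq_ordLess_trans by blast
qed

text \<open>The coordinate of \<open>x\<close> in copy \<open>a\<close> of the segment below
  \<open>j\<close>, within the family reserved for \<open>(j, p)\<close>. As \<open>e\<close> is
  injective, distinct quadruples get distinct coordinates.\<close>

definition slot :: "'m \<Rightarrow> 'm \<Rightarrow> 'm \<Rightarrow> 'm \<Rightarrow> 'm" where
  "slot j p a x = e (e (j, p), e (a, x))"

definition decodes :: "('m \<Rightarrow> 'b) \<Rightarrow> 'm \<Rightarrow> 'm \<Rightarrow> ('m \<Rightarrow> 'b) \<Rightarrow> bool" where
  "decodes f j p h \<longleftrightarrow> \<not> finite (underS r p) \<and>
    |{a \<in> underS r p. \<exists>x\<in>underS r j. f (slot j p a x) \<noteq> h x}| <o |underS r p|"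

text \<open>Two exceptional sets smaller than the infinite \<open>underS r p\<close> cannot cover
  it; on a copy outside both, \<open>f\<close> agrees with \<open>h\<close> and with
  \<open>h'\<close>.\<close>

lemma decodes_unique:
  assumes "decodes f j p h" "decodes f j p h'" "x \<in> underS r j"
  shows "h x = h' x"
proof -
  let ?E = "\<lambda>h. {a \<in> underS r p. \<exists>x\<in>underS r j. f (slot j p a x) \<noteq> h x}"
  have "|?E h \<union> ?E h'| <o |underS r p|"
    using assms(1,2) card_of_Un_ordLess_infinite unfolding decodes_def by blast
  then have "?E h \<union> ?E h' \<noteq> underS r p" using ordLess_irreflexive by metis
  then obtain a where "a \<in> underS r p" "a \<notin> ?E h" "a \<notin> ?E h'" by blast
  then show ?thesis using assms(3) by auto
qed

lemma nowhere_dense_not_decodes: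
  fixes h :: "'m \<Rightarrow> 'b"
  shows "nowhere_dense_in (box_topology r) {f. \<forall>p\<in>K. \<not> decodes f j p h}"
  unfolding nowhere_dense_box_iff
proof (intro allI impI)
  fix s :: "'m \<rightharpoonup> 'b" assume s: "|dom s| <o r"
  obtain p where p: "p \<in> K" "|dom s| <o |underS r p|" "\<not> finite (underS r p)"
    using ex_K_underS_large[OF s] by blast
  define R where "R = (\<lambda>(a, x). slot j p a x) ` (underS r p \<times> underS r j)"
  \<comment> \<open>Writes \<open>h\<close> into every copy wherever \<open>s\<close> leaves room;
    the nested inverses recover \<open>x\<close> from \<open>slot j p a x\<close>.\<close>
  define t where "t y = (if y \<in> dom s then s y else
    if y \<in> R then Some (h (snd (inv e (snd (inv e y))))) else None)" for y
  have "|R| <o r"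
    unfolding R_def using Times_ordLess[OF underS_ordLess underS_ordLess]
    by (rule ordLeq_ordLess_trans[OF card_of_image])
  moreover have "dom t \<subseteq> dom s \<union> R" unfolding t_def by (auto split: if_splits)
  ultimately have "|dom t| <o r" using s Un_ordLess subset_ordLess by blast
  moreover have "s \<subseteq>\<^sub>m t" unfolding t_def map_le_def by auto
  moreover have "decodes f j p h" if f: "f \<in> cyl t" for f
  proof -
    let ?E = "{a \<in> underS r p. \<exists>x\<in>underS r j. f (slot j p a x) \<noteq> h x}"
    \<comment> \<open>A copy can go wrong only at a coordinate fixed by \<open>s\<close>, and that
      coordinate determines \<open>a\<close>. So at most \<open>|dom s|\<close> copies are
      bad.\<close>
    have "?E \<subseteq> (\<lambda>y. fst (inv e (snd (inv e y)))) ` dom s"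
    proof
      fix a assume "a \<in> ?E"
      then obtain x where x: "a \<in> underS r p" "x \<in> underS r j" "f (slot j p a x) \<noteq> h x" by blast
      then have "slot j p a x \<in> R" unfolding R_def by auto
      then have "t (slot j p a x) = Some (h x)" if "slot j p a x \<notin> dom s"
        unfolding t_def using that by (simp add: slot_def)
      then have "slot j p a x \<in> dom s" using f x(3) unfolding mem_cyl_iff by blast
      moreover have "a = fst (inv e (snd (inv e (slot j p a x))))" by (simp add: slot_def)
      ultimately show "a \<in> (\<lambda>y. fst (inv e (snd (inv e y)))) ` dom s" by blast
    qed
    then have "|?E| <o |underS r p|" using surj_imp_ordLeq p(2) ordLeq_ordLess_trans by blast
    then show ?thesis using p(3) unfolding decodes_def by blast
  qed
  ultimately show "\<exists>t. s \<subseteq>\<^sub>m t \<and> |dom t| <o r \<and> cyl t \<inter> {f. \<forall>p\<in>K. \<not> decodes f j p h} = {}"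
    using p(1) by blast
qed

lemma nonmeagre_fun_ordLeq_Times_Pow:
  fixes Y :: "('m \<Rightarrow> 'b) set"
  assumes "\<not> meagre_k k (box_topology r) Y"
  shows "|UNIV :: ('m \<Rightarrow> 'b) set| \<le>o |Y \<times> Pow (K \<times> K)|"
proof -
  have "\<exists>f\<in>Y. \<forall>j\<in>K. \<exists>p\<in>K. decodes f j p h" for h
  proof (rule ccontr)
    let ?N = "\<lambda>j. {f. \<forall>p\<in>K. \<not> decodes f j p h}"
    assume "\<not> ?thesis"
    then have "Y \<subseteq> \<Union> (?N ` K)" by blast
    moreover have "|?N ` K| \<le>o k" using card_of_image K(2) ordLeq_ordIso_trans by blast
    ultimately have "meagre_k k (box_topology r) Y"
      using nowhere_dense_not_decodes
      by (intro meagre_k_subset[OF _ _ _ nowhere_dense_box_subset]) auto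
    then show False using assms by blast
  qed
  then obtain g where g: "\<And>h. g h \<in> Y" "\<And>h j. j \<in> K \<Longrightarrow> \<exists>p\<in>K. decodes (g h) j p h"
    by metis
  \<comment> \<open>One \<open>f\<close> may decode different functions via different
    \<open>p\<close>; the second component records which \<open>p\<close> to trust for each
    \<open>j\<close>.\<close>
  let ?c = "\<lambda>h. (g h, {(j, p). j \<in> K \<and> p \<in> K \<and> decodes (g h) j p h})"
  have "inj ?c"
  proof (rule injI, rule ext)
    fix h h' x assume eq: "?c h = ?c h'"
    obtain j where j: "j \<in> K" "x \<in> underS r j" using ex_underS_K by blast
    obtain p where p: "p \<in> K" "decodes (g h) j p h" using g(2) j(1) by blast
    then have "decodes (g h') j p h'" using eq j(1) by blast
    then show "h x = h' x" using decodes_unique[OF p(2) _ j(2)] eq by simp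
  qed
  moreover have "range ?c \<subseteq> Y \<times> Pow (K \<times> K)" using g(1) by auto
  ultimately show ?thesis using card_of_ordLeq by blast
qed

section \<open>Diagonalisation over blocks, and the size of nonmeagre sets\<close>

lemma Pow_ordLeq_nonmeagre:
  fixes Y :: "('m \<Rightarrow> bool) set"
  assumes "\<not> meagre_k k (box_topology r) Y"
  shows "|Pow (K \<times> K)| \<le>o |Y|"
proof (rule ccontr)
  assume "\<not> ?thesis"
  then have less: "|Y| <o |Pow (K \<times> K)|" using not_ordLess_iff_ordLeq card_of_Well_order by metis
  \<comment> \<open>\<open>B a f\<close> is the subset of \<open>K \<times> K\<close> that
    \<open>f\<close> spells out on block \<open>a\<close>. Members of \<open>Y\<close> are too few
    to spell out every subset there, so some \<open>g a\<close> is missed.\<close>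
  define B where "B a f = {q \<in> K \<times> K. f (e (a, e q))}" for a and f :: "'m \<Rightarrow> bool"
  have "\<exists>g. g \<subseteq> K \<times> K \<and> g \<notin> B a ` Y" for a
  proof (rule ccontr)
    assume "\<not> ?thesis"
    then have "Pow (K \<times> K) \<subseteq> B a ` Y" by auto
    then show False using surj_imp_ordLeq less not_ordLess_ordLeq by metis
  qed
  then obtain g where g: "\<And>a. g a \<subseteq> K \<times> K" "\<And>a. g a \<notin> B a ` Y" by metis
  have "nowhere_dense_in (box_topology r) Y"
    unfolding nowhere_dense_box_iff
  proof (intro allI impI)
    fix s :: "'m \<rightharpoonup> bool" assume s: "|dom s| <o r"
    have "|(\<lambda>y. fst (inv e y)) ` dom s| <o r" using s card_of_image ordLeq_ordLess_trans by blast
    \<comment> \<open>Some block is untouched by \<open>s\<close>; writing \<open>g a\<close> into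
      it excludes all of \<open>Y\<close> at once.\<close>
    then obtain a where a: "a \<notin> (\<lambda>y. fst (inv e y)) ` dom s" using ordLess_imp_neq_UNIV by blast
    define R where "R = (\<lambda>q. e (a, e q)) ` (K \<times> K)"
    define t where "t y = (if y \<in> dom s then s y else
      if y \<in> R then Some (inv e (snd (inv e y)) \<in> g a) else None)" for y
    have "|R| <o r" unfolding R_def using Times_ordLess[OF K_ordLess K_ordLess]
      by (rule ordLeq_ordLess_trans[OF card_of_image])
    moreover have "dom t \<subseteq> dom s \<union> R" unfolding t_def by (auto split: if_splits)
    ultimately have "|dom t| <o r" using s Un_ordLess subset_ordLess by blast
    moreover have "s \<subseteq>\<^sub>m t" unfolding t_def map_le_def by auto
    moreover have "B a f = g a" if f: "f \<in> cyl t" for f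
    proof -
      have "f (e (a, e q)) \<longleftrightarrow> q \<in> g a" if q: "q \<in> K \<times> K" for q
      proof -
        have "e (a, e q) \<notin> dom s" using a by (metis fst_conv image_eqI inv_e)
        moreover have "e (a, e q) \<in> R" using q unfolding R_def by blast
        ultimately have "t (e (a, e q)) = Some (q \<in> g a)" unfolding t_def by simp
        then show ?thesis using f unfolding mem_cyl_iff by blast
      qed
      then show ?thesis using g(1) unfolding B_def by blast
    qed
    then have "cyl t \<inter> Y = {}" using g(2) by blast
    ultimately show "\<exists>t. s \<subseteq>\<^sub>m t \<and> |dom t| <o r \<and> cyl t \<inter> Y = {}" by blast
  qed
  moreover have "|{Y}| \<le>o k"
    using finite_ordLess_Card_order[OF inf_k Card_k, of "{Y}"] ordLess_imp_ordLeq by blast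
  ultimately have "meagre_k k (box_topology r) Y"
    unfolding meagre_k_def by (intro exI[of _ "{Y}"]) auto
  then show False using assms by blast
qed

theorem nonmeagre_card:
  fixes Y :: "('m \<Rightarrow> bool) set"
  assumes "\<not> meagre_k k (box_topology r) Y"
  shows "|UNIV :: ('m \<Rightarrow> bool) set| \<le>o |Y|"
proof -
  have Pow: "|Pow (K \<times> K)| \<le>o |Y|" by (rule Pow_ordLeq_nonmeagre[OF assms])
  have "\<not> finite (Pow (K \<times> K))" using K_infinite by (auto simp: finite_cartesian_product_iff)
  then have "\<not> finite Y" using card_of_ordLeq_infinite[OF Pow] by blast
  \<comment> \<open>The factor for the recorded pairs is absorbed by the infinite
    \<open>Y\<close>.\<close>
  then have "|Y \<times> Pow (K \<times> K)| =o |Y|"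
    using card_of_Times_infinite[of Y "Pow (K \<times> K)"] Pow by blast
  then show ?thesis
    using nonmeagre_fun_ordLeq_Times_Pow[OF assms] ordLeq_ordIso_trans by blast
qed

text \<open>A function is determined by its graph, which \<open>e\<close> codes as a predicate on
  \<open>'m\<close>.\<close>

lemma fun_ordLeq_pred: "|UNIV :: ('m \<Rightarrow> 'm) set| \<le>o |UNIV :: ('m \<Rightarrow> bool) set|"
proof -
  have "inj (\<lambda>f y. \<exists>a. y = e (a, f a))"
  proof (rule injI, rule ext)
    fix f g :: "'m \<Rightarrow> 'm" and x
    assume "(\<lambda>y. \<exists>a. y = e (a, f a)) = (\<lambda>y. \<exists>a. y = e (a, g a))"
    then have "\<exists>a. e (x, f x) = e (a, g a)" by metis
    then show "f x = g x" using inj_e by (auto dest: injD)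
  qed
  then show ?thesis using card_of_ordLeq by blast
qed

end

text \<open>\<open>\<mu>^{<\<mu>}\<close> is the supremum of the powers \<open>\<mu>^|D|\<close>
  with \<open>|D| < \<mu>\<close>, so each of these is bounded separately. Equality of the two
  \<open>non\<close> values means that a nonmeagre set in either space is matched by one in the
  other that is no larger.\<close>

theorem mainTheorem12:
  fixes k :: "'k rel" and r :: "'m rel"
  assumes "Card_order k" and "cinfinite k" and "regularCard k"
    and "card_order r" and "cinfinite r" and "\<not> regularCard r"
    and "cofinality_is r k"
  shows "(\<forall>Y :: ('m \<Rightarrow> bool) set. \<not> meagre_k k (box_topology r) Y \<longrightarrow>
            (\<forall>D :: 'm set. (card_of D, r) \<in> ordLess \<longrightarrow> (BNF_Cardinal_Arithmetic.cexp r (card_of D), card_of Y) \<in> ordLeq))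
       \<and> (\<forall>Y :: ('m \<Rightarrow> bool) set. \<not> meagre_k k (box_topology r) Y \<longrightarrow>
            (\<exists>Z :: ('m \<Rightarrow> 'm) set. \<not> meagre_k k (box_topology r) Z \<and> (card_of Z, card_of Y) \<in> ordLeq))
       \<and> (\<forall>Z :: ('m \<Rightarrow> 'm) set. \<not> meagre_k k (box_topology r) Z \<longrightarrow>
            (\<exists>Y :: ('m \<Rightarrow> bool) set. \<not> meagre_k k (box_topology r) Y \<and> (card_of Y, card_of Z) \<in> ordLeq))"
proof -
  have Field: "Field r = UNIV" and Card: "Card_order r"
    using assms(4) card_order_on_Card_order by auto
  have inf_UNIV: "\<not> finite (UNIV :: 'm set)" using assms(5) Field unfolding cinfinite_def by simp
  obtain K where K: "cofinal K r" "|K| =o k" using assms(7) unfolding cofinality_is_def by blast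
  have "|UNIV :: ('m \<times> 'm) set| =o |UNIV :: 'm set|"
    using card_of_Times_same_infinite[OF inf_UNIV] by simp
  then obtain e :: "'m \<times> 'm \<Rightarrow> 'm" where e: "inj e"
    by (metis card_of_ordIso bij_betw_def)
  interpret singular_box r k K e
    using assms Field Card K e by unfold_locales (auto simp: cinfinite_def)
  have fun_le: "|UNIV :: ('m \<Rightarrow> 'm) set| \<le>o |Y|"
    if "\<not> meagre_k k (box_topology r) Y" for Y :: "('m \<Rightarrow> bool) set"
    using ordLeq_transitive[OF fun_ordLeq_pred nonmeagre_card[OF that]] .
  have "BNF_Cardinal_Arithmetic.cexp r |D| \<le>o |Y|"
    if "\<not> meagre_k k (box_topology r) Y" for Y :: "('m \<Rightarrow> bool) set" and D :: "'m set"
    \<comment> \<open>The power is the size of a set of total functions, constantly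
      \<open>undefined\<close> off \<open>D\<close>, hence of a subset of all functions
      \<open>'m \<Rightarrow> 'm\<close>.\<close>
    unfolding cexp_def by (rule ordLeq_transitive[OF card_of_mono1 fun_le[OF that]]) simp
  moreover have "\<exists>Z :: ('m \<Rightarrow> 'm) set. \<not> meagre_k k (box_topology r) Z \<and> |Z| \<le>o |Y|"
    if "\<not> meagre_k k (box_topology r) Y" for Y :: "('m \<Rightarrow> bool) set"
    \<comment> \<open>The witness is the whole space, nonmeagre by Baire category.\<close>
    using fun_le[OF that] box_topology_Baire by blast
  moreover have "\<exists>Y :: ('m \<Rightarrow> bool) set. \<not> meagre_k k (box_topology r) Y \<and> |Y| \<le>o |Z|"
    if "\<not> meagre_k k (box_topology r) Z" for Z :: "('m \<Rightarrow> 'm) set"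
  proof -
    fix a :: 'm
    have "infinite (- {a})" using inf_UNIV by (simp add: infinite_remove Compl_eq_Diff_UNIV)
    then obtain b where "b \<noteq> a" using infinite_imp_nonempty by blast
    then have "surj (\<lambda>x. x = a)" unfolding surj_def by metis
    then have "\<not> meagre_k k (box_topology r) ((\<lambda>f. (\<lambda>x. x = a) \<circ> f) ` Z)"
      using meagre_k_comp_image that by metis
    then show ?thesis using card_of_image by metis
  qed
  ultimately show ?thesis by blast
qed

end
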